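(* Let $A=(A,\cdot,\circ)$ be any skew brace. Then $\mathrm{Ann}_2(A)*(A*A)=1$ and $[\mathrm{Ann}_2(A),A*A]=1$.
   Context: A skew brace is a set $A=(A,\cdot,\circ)$ with two group operations $\cdot$ and $\circ$ such that $a\circ(b\cdot c)=(a\circ b)\cdot a^{-1}\cdot(a\circ c)$ for all $a,b,c\in A$, where $a^{-1}$ is the inverse of $a$ in $(A,\cdot)$. The two groups share the same identity element, denoted $1$; the trivial subgroup $\{1\}$ is also written $1$. For $a,b\in A$ put $a*b=a^{-1}\cdot(a\circ b)\cdot b^{-1}$; for subsets $X,Y\subseteq A$, $X*Y$ is the subgroup of $(A,\cdot)$ generated by all $x*y$ with $x\in X$, $y\in Y$. The bracket $[\,,\,]$ denotes the commutator in the group $(A,\cdot)$: $[a,b]=a\cdot b\cdot a^{-1}\cdot b^{-1}$, and $[X,Y]$ is the subgroup of $(A,\cdot)$ generated by all $[x,y]$ with $x\in X$, $y\in Y$. An ideal of $A$ is a subset $I$ that is a normal subgroup of both $(A,\cdot)$ and $(A,\circ)$ with $a\cdot I=a\circ I$ for all $a\in A$; then $A/I$ is naturally a skew brace. The annihilator of $A$ is the ideal $\mathrm{Ann}(A)=\{a\in A\mid \forall x\in A:\ a*x=1=x*a\}\cap Z(A,\cdot)$, where $Z$ denotes the center of a group. The second annihilator $\mathrm{Ann}_2(A)$ is the unique ideal of $A$ containing $\mathrm{Ann}(A)$ with $\mathrm{Ann}(A/\mathrm{Ann}(A))=\mathrm{Ann}_2(A)/\mathrm{Ann}(A)$. The derived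 ideal of $A$ is $A*A$. *)

theory Defs
  imports "HOL-Algebra.Generated_Groups"
begin

(* A skew brace is a pair of group structures on the same carrier: G is the dot group (A, \<cdot>) and C
   is the circle group (A, \<circ>).  That the two identities coincide is a consequence, not a hypothesis
   (see one_eq below). *)
locale skew_brace = dot: group G + circ: group C
  for G :: "('a, 'b) monoid_scheme" (structure) and C :: "('a, 'c) monoid_scheme" +
  assumes carrier_eq: "carrier C = carrier G"
    and brace: "\<lbrakk>a \<in> carrier G; b \<in> carrier G; c \<in> carrier G\<rbrakk> \<Longrightarrow>
      a \<otimes>\<^bsub>C\<^esub> (b \<otimes> c) = (a \<otimes>\<^bsub>C\<^esub> b) \<otimes> inv a \<otimes> (a \<otimes>\<^bsub>C\<^esub> c)"

definition star :: "('a, 'b) monoid_scheme \<Rightarrow> ('a, 'c) monoid_scheme \<Rightarrow> 'a \<Rightarrow> 'a \<Rightarrow> 'a" where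
  "star G C a b = inv\<^bsub>G\<^esub> a \<otimes>\<^bsub>G\<^esub> (a \<otimes>\<^bsub>C\<^esub> b) \<otimes>\<^bsub>G\<^esub> inv\<^bsub>G\<^esub> b"

definition star_sets ::
    "('a, 'b) monoid_scheme \<Rightarrow> ('a, 'c) monoid_scheme \<Rightarrow> 'a set \<Rightarrow> 'a set \<Rightarrow> 'a set" where
  "star_sets G C X Y = generate G {star G C x y | x y. x \<in> X \<and> y \<in> Y}"

definition bracket :: "('a, 'b) monoid_scheme \<Rightarrow> 'a \<Rightarrow> 'a \<Rightarrow> 'a" where
  "bracket G a b = a \<otimes>\<^bsub>G\<^esub> b \<otimes>\<^bsub>G\<^esub> inv\<^bsub>G\<^esub> a \<otimes>\<^bsub>G\<^esub> inv\<^bsub>G\<^esub> b"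

definition bracket_sets :: "('a, 'b) monoid_scheme \<Rightarrow> 'a set \<Rightarrow> 'a set \<Rightarrow> 'a set" where
  "bracket_sets G X Y = generate G {bracket G x y | x y. x \<in> X \<and> y \<in> Y}"

definition center :: "('a, 'b) monoid_scheme \<Rightarrow> 'a set" where
  "center G = {z \<in> carrier G. \<forall>x \<in> carrier G. z \<otimes>\<^bsub>G\<^esub> x = x \<otimes>\<^bsub>G\<^esub> z}"

definition brace_ideal :: "('a, 'b) monoid_scheme \<Rightarrow> ('a, 'c) monoid_scheme \<Rightarrow> 'a set \<Rightarrow> bool" where
  "brace_ideal G C I \<longleftrightarrow>
     I \<lhd> G \<and> I \<lhd> C \<and> (\<forall>a \<in> carrier G. a <#\<^bsub>G\<^esub> I = a <#\<^bsub>C\<^esub> I)"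

definition Ann :: "('a, 'b) monoid_scheme \<Rightarrow> ('a, 'c) monoid_scheme \<Rightarrow> 'a set" where
  "Ann G C =
     {a \<in> carrier G. \<forall>x \<in> carrier G. star G C a x = \<one>\<^bsub>G\<^esub> \<and> star G C x a = \<one>\<^bsub>G\<^esub>} \<inter> center G"

definition derived_ideal :: "('a, 'b) monoid_scheme \<Rightarrow> ('a, 'c) monoid_scheme \<Rightarrow> 'a set" where
  "derived_ideal G C = star_sets G C (carrier G) (carrier G)"

(* For an ideal I, the skew brace A/I is the pair (G Mod I, C Mod I), and for an ideal J containing I
   the subset J/I of A/I is the set of cosets of I by elements of J.  The definite description is
   justified by ex1_Ann2 at the end of this theory. *)
definition Ann2 :: "('a, 'b) monoid_scheme \<Rightarrow> ('a, 'c) monoid_scheme \<Rightarrow> 'a set" where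
  "Ann2 G C = (THE J. brace_ideal G C J \<and> Ann G C \<subseteq> J \<and>
     Ann (G Mod Ann G C) (C Mod Ann G C) = (\<lambda>a. Ann G C #>\<^bsub>G\<^esub> a) ` J)"

context skew_brace
begin

lemma circ_closed [simp]:
  "\<lbrakk>a \<in> carrier G; b \<in> carrier G\<rbrakk> \<Longrightarrow> a \<otimes>\<^bsub>C\<^esub> b \<in> carrier G"
  using circ.m_closed carrier_eq by auto

lemma one_eq: "\<one>\<^bsub>C\<^esub> = \<one>"
proof -
  have c: "\<one>\<^bsub>C\<^esub> \<in> carrier G" using carrier_eq by auto
  have "\<one>\<^bsub>C\<^esub> \<otimes>\<^bsub>C\<^esub> (\<one> \<otimes> \<one>) = (\<one>\<^bsub>C\<^esub> \<otimes>\<^bsub>C\<^esub> \<one>) \<otimes> inv \<one>\<^bsub>C\<^esub> \<otimes> (\<one>\<^bsub>C\<^esub> \<otimes>\<^bsub>C\<^esub> \<one>)"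
    using c by (intro brace) auto
  then have "\<one> = inv \<one>\<^bsub>C\<^esub>" using c carrier_eq by simp
  then show ?thesis using c by (metis dot.inv_inv dot.inv_one)
qed

lemma star_one_iff:
  assumes "a \<in> carrier G" "b \<in> carrier G"
  shows "star G C a b = \<one> \<longleftrightarrow> a \<otimes>\<^bsub>C\<^esub> b = a \<otimes> b"
proof -
  have "star G C a b = \<one> \<longleftrightarrow> inv a \<otimes> (a \<otimes>\<^bsub>C\<^esub> b) = b"
    unfolding star_def using assms dot.inv_equality dot.inv_solve_right' by auto
  also have "\<dots> \<longleftrightarrow> a \<otimes>\<^bsub>C\<^esub> b = a \<otimes> b"
    using assms by (metis circ_closed dot.inv_solve_left)
  finally show ?thesis .
qed

lemma Ann_iff:
  "n \<in> Ann G C \<longleftrightarrow> n \<in> carrier G \<and>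
     (\<forall>x \<in> carrier G. n \<otimes>\<^bsub>C\<^esub> x = n \<otimes> x \<and> x \<otimes>\<^bsub>C\<^esub> n = n \<otimes> x \<and> x \<otimes> n = n \<otimes> x)"
proof -
  have "n \<in> Ann G C \<longleftrightarrow> n \<in> carrier G \<and> (\<forall>x \<in> carrier G.
      (star G C n x = \<one> \<and> star G C x n = \<one>) \<and> n \<otimes> x = x \<otimes> n)"
    unfolding Ann_def center_def by blast
  also have "\<dots> \<longleftrightarrow> n \<in> carrier G \<and> (\<forall>x \<in> carrier G.
      (n \<otimes>\<^bsub>C\<^esub> x = n \<otimes> x \<and> x \<otimes>\<^bsub>C\<^esub> n = x \<otimes> n) \<and> n \<otimes> x = x \<otimes> n)"
    using star_one_iff by blast
  finally show ?thesis by metis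
qed

lemma AnnD:
  assumes "n \<in> Ann G C"
  shows "n \<in> carrier G" "\<And>x. x \<in> carrier G \<Longrightarrow> n \<otimes>\<^bsub>C\<^esub> x = n \<otimes> x"
    "\<And>x. x \<in> carrier G \<Longrightarrow> x \<otimes>\<^bsub>C\<^esub> n = n \<otimes> x" "\<And>x. x \<in> carrier G \<Longrightarrow> x \<otimes> n = n \<otimes> x"
  using iffD1[OF Ann_iff assms] by blast+

lemma Ann_m_closed:
  assumes n: "n \<in> Ann G C" and m: "m \<in> Ann G C" shows "n \<otimes> m \<in> Ann G C"
proof -
  note N = AnnD[OF n] and M = AnnD[OF m]
  have "(n \<otimes> m) \<otimes>\<^bsub>C\<^esub> x = n \<otimes> m \<otimes> x \<and> x \<otimes>\<^bsub>C\<^esub> (n \<otimes> m) = n \<otimes> m \<otimes> x \<and> x \<otimes> (n \<otimes> m) = n \<otimes> m \<otimes> x"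
    if x: "x \<in> carrier G" for x
  proof (intro conjI)
    show "x \<otimes> (n \<otimes> m) = n \<otimes> m \<otimes> x"
      using N(1,4) M(1,4) x by (metis dot.m_assoc)
    have "(n \<otimes> m) \<otimes>\<^bsub>C\<^esub> x = n \<otimes>\<^bsub>C\<^esub> (m \<otimes>\<^bsub>C\<^esub> x)"
      using N M x carrier_eq by (metis circ.m_assoc)
    then show "(n \<otimes> m) \<otimes>\<^bsub>C\<^esub> x = n \<otimes> m \<otimes> x"
      using N(1,2) M(1,2) x by (simp add: dot.m_assoc)
    have "x \<otimes>\<^bsub>C\<^esub> (n \<otimes> m) = (x \<otimes>\<^bsub>C\<^esub> n) \<otimes>\<^bsub>C\<^esub> m"
      using N M x carrier_eq by (metis circ.m_assoc)
    also have "\<dots> = m \<otimes> (n \<otimes> x)" using N M x by simp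
    finally show "x \<otimes>\<^bsub>C\<^esub> (n \<otimes> m) = n \<otimes> m \<otimes> x"
      using N(1,4) M(1,4) x by (metis dot.m_assoc)
  qed
  then show ?thesis using N(1) M(1) Ann_iff by blast
qed

lemma Ann_inv:
  assumes n: "n \<in> Ann G C" shows "inv n \<in> Ann G C" "inv\<^bsub>C\<^esub> n = inv n"
proof -
  note N = AnnD[OF n]
  show i: "inv\<^bsub>C\<^esub> n = inv n"
  proof (rule circ.inv_equality)
    show "inv n \<otimes>\<^bsub>C\<^esub> n = \<one>\<^bsub>C\<^esub>" using N one_eq by simp
  qed (use N carrier_eq in auto)
  have "inv n \<otimes>\<^bsub>C\<^esub> x = inv n \<otimes> x \<and> x \<otimes>\<^bsub>C\<^esub> inv n = inv n \<otimes> x \<and> x \<otimes> inv n = inv n \<otimes> x"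
    if x: "x \<in> carrier G" for x
  proof (intro conjI)
    show c: "x \<otimes> inv n = inv n \<otimes> x"
      using N(1,4) x by (metis dot.inv_closed dot.inv_solve_left dot.inv_solve_right dot.m_assoc dot.m_closed)
    have "n \<otimes>\<^bsub>C\<^esub> (inv n \<otimes> x) = x"
      using N(1,2) x by (simp flip: dot.m_assoc)
    then show "inv n \<otimes>\<^bsub>C\<^esub> x = inv n \<otimes> x"
      using N(1) x i carrier_eq by (metis circ.inv_solve_left dot.inv_closed dot.m_closed)
    have "(inv n \<otimes> x) \<otimes>\<^bsub>C\<^esub> n = x"
      using N(1,3) x by (simp flip: dot.m_assoc)
    then show "x \<otimes>\<^bsub>C\<^esub> inv n = inv n \<otimes> x"
      using N(1) x i carrier_eq by (metis circ.inv_solve_right dot.inv_closed dot.m_closed)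
  qed
  then show "inv n \<in> Ann G C" using N(1) Ann_iff by blast
qed

lemma one_Ann: "\<one> \<in> Ann G C"
proof -
  have "\<one> \<otimes>\<^bsub>C\<^esub> x = x \<and> x \<otimes>\<^bsub>C\<^esub> \<one> = x" if "x \<in> carrier G" for x
    using that carrier_eq by (metis circ.l_one circ.r_one one_eq)
  then show ?thesis using Ann_iff[of "\<one>"] by simp
qed

lemma Ann_normal_dot: "Ann G C \<lhd> G"
proof (rule dot.normal_invI)
  show "subgroup (Ann G C) G"
    by (rule dot.subgroupI) (use AnnD(1) one_Ann Ann_inv Ann_m_closed in auto)
next
  fix x h assume xh: "x \<in> carrier G" "h \<in> Ann G C"
  then have "x \<otimes> h \<otimes> inv x = h" using AnnD[OF xh(2)] by (simp add: dot.m_assoc)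
  then show "x \<otimes> h \<otimes> inv x \<in> Ann G C" using xh by simp
qed

lemma Ann_normal_circ: "Ann G C \<lhd> C"
proof (rule circ.normal_invI)
  show "subgroup (Ann G C) C"
  proof (rule circ.subgroupI)
    fix a b assume "a \<in> Ann G C" "b \<in> Ann G C"
    then show "a \<otimes>\<^bsub>C\<^esub> b \<in> Ann G C" using AnnD Ann_m_closed by metis
  qed (use AnnD(1) one_Ann Ann_inv carrier_eq in auto)
next
  fix x h assume xh: "x \<in> carrier C" "h \<in> Ann G C"
  then have "x \<otimes>\<^bsub>C\<^esub> h = h \<otimes>\<^bsub>C\<^esub> x" using AnnD[OF xh(2)] carrier_eq by simp
  moreover have "h \<in> carrier C" using xh(2) AnnD(1) carrier_eq by simp
  ultimately have "x \<otimes>\<^bsub>C\<^esub> h \<otimes>\<^bsub>C\<^esub> inv\<^bsub>C\<^esub> x = h"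
    using xh(1) by (simp add: circ.m_assoc)
  then show "x \<otimes>\<^bsub>C\<^esub> h \<otimes>\<^bsub>C\<^esub> inv\<^bsub>C\<^esub> x \<in> Ann G C" using xh by simp
qed

lemma brace_ideal_Ann: "brace_ideal G C (Ann G C)"
proof -
  have "a <#\<^bsub>G\<^esub> Ann G C = a <#\<^bsub>C\<^esub> Ann G C" if "a \<in> carrier G" for a
    using that AnnD(3,4) by (auto simp: l_coset_def)
  then show ?thesis
    by (simp add: brace_ideal_def Ann_normal_dot Ann_normal_circ)
qed

lemma ideal_cosets:
  assumes "brace_ideal G C I" "a \<in> carrier G"
  shows "I #>\<^bsub>C\<^esub> a = I #> a"
proof -
  have "I #>\<^bsub>C\<^esub> a = a <#\<^bsub>C\<^esub> I" "I #> a = a <# I"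
    using assms carrier_eq unfolding brace_ideal_def
    by (auto simp: normal.coset_eq)
  then show ?thesis using assms by (simp add: brace_ideal_def)
qed

lemma quotient_mult:
  assumes "brace_ideal G C I" "a \<in> carrier G" "b \<in> carrier G"
  shows "(I #> a) \<otimes>\<^bsub>G Mod I\<^esub> (I #> b) = I #> (a \<otimes> b)"
    and "(I #> a) \<otimes>\<^bsub>C Mod I\<^esub> (I #> b) = I #> (a \<otimes>\<^bsub>C\<^esub> b)"
proof -
  have n: "I \<lhd> G" "I \<lhd> C" using assms by (auto simp: brace_ideal_def)
  show "(I #> a) \<otimes>\<^bsub>G Mod I\<^esub> (I #> b) = I #> (a \<otimes> b)"
    using normal.rcos_sum[OF n(1)] assms by simp
  show "(I #> a) \<otimes>\<^bsub>C Mod I\<^esub> (I #> b) = I #> (a \<otimes>\<^bsub>C\<^esub> b)"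
    using normal.rcos_sum[OF n(2), of a b] assms carrier_eq ideal_cosets[OF assms(1)] by simp
qed

lemma quotient_skew_brace:
  assumes I: "brace_ideal G C I"
  shows "skew_brace (G Mod I) (C Mod I)"
proof -
  have n: "I \<lhd> G" "I \<lhd> C" using I by (auto simp: brace_ideal_def)
  interpret Q: group "G Mod I" by (rule normal.factorgroup_is_group[OF n(1)])
  interpret R: group "C Mod I" by (rule normal.factorgroup_is_group[OF n(2)])
  have inv: "inv\<^bsub>G Mod I\<^esub> (I #> a) = I #> inv a" if "a \<in> carrier G" for a
    using that normal.inv_FactGroup[OF n(1)] normal.rcos_inv[OF n(1)]
    by (simp add: carrier_FactGroup)
  show ?thesis
  proof unfold_locales
    show "carrier (C Mod I) = carrier (G Mod I)"
      using ideal_cosets[OF I] carrier_eq by (auto simp: carrier_FactGroup)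
  next
    fix x y z assume "x \<in> carrier (G Mod I)" "y \<in> carrier (G Mod I)" "z \<in> carrier (G Mod I)"
    then obtain a b c where abc: "a \<in> carrier G" "b \<in> carrier G" "c \<in> carrier G"
      and xyz: "x = I #> a" "y = I #> b" "z = I #> c" by (auto simp: carrier_FactGroup)
    show "x \<otimes>\<^bsub>C Mod I\<^esub> (y \<otimes>\<^bsub>G Mod I\<^esub> z) =
      (x \<otimes>\<^bsub>C Mod I\<^esub> y) \<otimes>\<^bsub>G Mod I\<^esub> inv\<^bsub>G Mod I\<^esub> x \<otimes>\<^bsub>G Mod I\<^esub> (x \<otimes>\<^bsub>C Mod I\<^esub> z)"
      unfolding xyz using abc by (simp only: inv quotient_mult[OF I] circ_closed dot.m_closed
        dot.inv_closed brace)
  qed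
qed

lemma ideal_eq_preimage:
  assumes I: "subgroup I G" and J: "subgroup J G" and "I \<subseteq> J"
  shows "J = {x \<in> carrier G. I #> x \<in> (\<lambda>a. I #> a) ` J}"
proof (intro equalityI subsetI)
  fix x assume "x \<in> {x \<in> carrier G. I #> x \<in> (\<lambda>a. I #> a) ` J}"
  then obtain a where x: "x \<in> carrier G" and a: "a \<in> J" "I #> x = I #> a" by auto
  then have "x \<in> I #> a" using dot.rcos_self[OF x I] by simp
  then show "x \<in> J" using a(1) assms(3) subgroup.m_closed[OF J] by (auto simp: r_coset_def)
qed (use subgroup.subset[OF J] in auto)

lemma ex1_Ann2:
  "\<exists>!J. brace_ideal G C J \<and> Ann G C \<subseteq> J \<and>
     Ann (G Mod Ann G C) (C Mod Ann G C) = (\<lambda>a. Ann G C #> a) ` J"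
proof (rule ex_ex1I)
  let ?N = "Ann G C"
  let ?B = "Ann (G Mod ?N) (C Mod ?N)"
  define J where "J = {x \<in> carrier G. ?N #> x \<in> ?B}"
  note N = brace_ideal_Ann
  have N': "?N \<lhd> G" "?N \<lhd> C" "subgroup ?N G"
    using Ann_normal_dot Ann_normal_circ by (auto simp: normal_imp_subgroup)
  interpret Q: skew_brace "G Mod ?N" "C Mod ?N" by (rule quotient_skew_brace[OF N])
  have J': "J = {x \<in> carrier C. ?N #>\<^bsub>C\<^esub> x \<in> ?B}"
    unfolding J_def using ideal_cosets[OF N] carrier_eq by auto
  have JG: "J \<lhd> G"
    using normal.factgroup_subgroup_union_normal[OF N'(1) Q.Ann_normal_dot]
      normal.factgroup_subgroup_union_char[OF N'(1) normal_imp_subgroup[OF Q.Ann_normal_dot]]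
    unfolding J_def by simp
  have JC: "J \<lhd> C"
    using normal.factgroup_subgroup_union_normal[OF N'(2) Q.Ann_normal_circ]
      normal.factgroup_subgroup_union_char[OF N'(2) normal_imp_subgroup[OF Q.Ann_normal_circ]]
    unfolding J' by simp
  have NJ: "?N \<subseteq> J"
  proof
    fix n assume n: "n \<in> ?N"
    then have "?N #> n = ?N" using N' AnnD(1) by (simp add: dot.coset_join2)
    then show "n \<in> J" using Q.one_Ann n AnnD(1) by (simp add: J_def)
  qed
  have img: "?B = (\<lambda>a. ?N #> a) ` J"
    using Q.AnnD(1) by (auto simp: J_def carrier_FactGroup)
  have "a <# J = a <#\<^bsub>C\<^esub> J" if a: "a \<in> carrier G" for a
  proof -
    have *: "?N #> (a \<otimes>\<^bsub>C\<^esub> p) = ?N #> (a \<otimes> p)" if p: "p \<in> J" for p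
    proof -
      have pc: "p \<in> carrier G" "?N #> p \<in> ?B" using p by (auto simp: J_def)
      have "(?N #> a) \<otimes>\<^bsub>C Mod ?N\<^esub> (?N #> p) = (?N #> a) \<otimes>\<^bsub>G Mod ?N\<^esub> (?N #> p)"
        using Q.AnnD(3,4)[OF pc(2), of "?N #> a"] a by (simp add: carrier_FactGroup del: mult_FactGroup)
      then show ?thesis using quotient_mult[OF N a pc(1)] by simp
    qed
    have J: "subgroup J G" "subgroup J C" using JG JC by (auto simp: normal_imp_subgroup)
    have Jc: "p \<in> carrier G" if "p \<in> J" for p using that by (simp add: J_def)
    show ?thesis
    proof (intro equalityI subsetI)
      fix y assume "y \<in> a <# J"
      then obtain p where p: "p \<in> J" "y = a \<otimes> p" by (auto simp: l_coset_def)
      then have "y \<in> ?N #> (a \<otimes>\<^bsub>C\<^esub> p)"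
        using *[OF p(1)] dot.rcos_self[OF _ N'(3), of y] a Jc by simp
      then obtain n where n: "n \<in> ?N" "y = n \<otimes> (a \<otimes>\<^bsub>C\<^esub> p)" by (auto simp: r_coset_def)
      then have "y = (a \<otimes>\<^bsub>C\<^esub> p) \<otimes>\<^bsub>C\<^esub> n" using AnnD(3) a Jc p(1) by simp
      then have "y = a \<otimes>\<^bsub>C\<^esub> (p \<otimes>\<^bsub>C\<^esub> n)"
        using a Jc[OF p(1)] AnnD(1)[OF n(1)] carrier_eq by (simp add: circ.m_assoc)
      moreover have "p \<otimes>\<^bsub>C\<^esub> n \<in> J" using J(2) p(1) n(1) NJ by (auto intro: subgroup.m_closed)
      ultimately show "y \<in> a <#\<^bsub>C\<^esub> J" by (auto simp: l_coset_def)
    next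
      fix y assume "y \<in> a <#\<^bsub>C\<^esub> J"
      then obtain p where p: "p \<in> J" "y = a \<otimes>\<^bsub>C\<^esub> p" by (auto simp: l_coset_def)
      then have "y \<in> ?N #> (a \<otimes> p)"
        using *[OF p(1)] dot.rcos_self[OF _ N'(3), of y] a Jc by simp
      then obtain n where n: "n \<in> ?N" "y = n \<otimes> (a \<otimes> p)" by (auto simp: r_coset_def)
      then have "y = (a \<otimes> p) \<otimes> n" using AnnD(4) a Jc p(1) by simp
      then have "y = a \<otimes> (p \<otimes> n)"
        using a Jc[OF p(1)] AnnD(1)[OF n(1)] by (simp add: dot.m_assoc)
      moreover have "p \<otimes> n \<in> J" using J(1) p(1) n(1) NJ by (auto intro: subgroup.m_closed)
      ultimately show "y \<in> a <# J" by (auto simp: l_coset_def)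
    qed
  qed
  then show "\<exists>J. brace_ideal G C J \<and> ?N \<subseteq> J \<and> ?B = (\<lambda>a. ?N #> a) ` J"
    using JG JC NJ img by (auto simp: brace_ideal_def)
next
  fix I J
  let ?N = "Ann G C"
  let ?B = "Ann (G Mod ?N) (C Mod ?N)"
  assume I: "brace_ideal G C I \<and> ?N \<subseteq> I \<and> ?B = (\<lambda>a. ?N #> a) ` I"
    and J: "brace_ideal G C J \<and> ?N \<subseteq> J \<and> ?B = (\<lambda>a. ?N #> a) ` J"
  then have "subgroup I G" "subgroup J G" "subgroup ?N G"
    using Ann_normal_dot by (auto simp: brace_ideal_def normal_imp_subgroup)
  then show "I = J"
    using I J ideal_eq_preimage[of ?N I] ideal_eq_preimage[of ?N J] by simp
qed

end

end

theory Submission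
  imports Defs
begin

text \<open>
  Let \<open>N\<close> be the annihilator and let \<open>z\<close> be in the second annihilator.  A skew brace carries an
  action \<open>\<lambda>\<close> of the circle group on the dot group by automorphisms,
  \<open>\<lambda>\<^sub>a(b) = a\<^sup>-\<^sup>1(a \<circ> b)\<close>, and \<open>a * b = \<lambda>\<^sub>a(b) b\<^sup>-\<^sup>1\<close>.
  Both claims say that an endomorphism \<open>\<phi>\<close> of the dot group fixes the derived ideal
  pointwise: \<open>\<phi> = \<lambda>\<^sub>z\<close> in the first and \<open>\<phi> =\<close> conjugation by \<open>z\<close> in the second.  The fixed
  points of \<open>\<phi>\<close> form a subgroup, so only the generators \<open>\<lambda>\<^sub>a(b) b\<^sup>-\<^sup>1\<close> matter.

  Since \<open>z\<close> annihilates \<open>A/N\<close>, each of these \<open>\<phi>\<close> moves \<open>b\<close> only by a factor in \<open>N\<close>, and such a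
  factor is central and fixed by every \<open>\<lambda>\<^sub>a\<close>.  Moreover \<open>\<phi>\<close> commutes with every \<open>\<lambda>\<^sub>a\<close>: in the
  first case because \<open>z \<circ> a\<close> and \<open>a \<circ> z\<close> differ by an element of \<open>N\<close>, on which \<open>\<lambda>\<close> is trivial; in
  the second because \<open>\<lambda>\<^sub>a(z)\<close> and \<open>z\<close> differ by a central factor and so induce the same
  conjugation.  Hence, writing \<open>\<phi>(b) = n b\<close>,
  \<open>\<phi>(\<lambda>\<^sub>a(b) b\<^sup>-\<^sup>1) = \<lambda>\<^sub>a(n b) (n b)\<^sup>-\<^sup>1 = \<lambda>\<^sub>a(b) b\<^sup>-\<^sup>1\<close>,
  which is \<open>fixes_twisted_quotient\<close> below.
\<close>

lemma (in group) generate_trivial: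
  assumes "S \<subseteq> {\<one>}"
  shows "generate G S = {\<one>}"
  using generate_subgroup_incl[OF assms triv_subgroup] generate.one[of G S] by auto

lemma (in group) fixed_points_subgroup:
  assumes "f \<in> hom G G"
  shows "subgroup {x \<in> carrier G. f x = x} G"
proof -
  interpret f: group_hom G G f by unfold_locales (rule assms)
  show ?thesis by (rule subgroupI) auto
qed

text \<open>The central factor \<open>n\<close> by which \<open>f\<close> moves \<open>b\<close> reappears in \<open>f (g b) = g (n b) = n g(b)\<close>,
  so it cancels in the quotient.\<close>

lemma (in group) fixes_twisted_quotient:
  assumes f: "f \<in> hom G G" and g: "g \<in> hom G G"
    and b: "b \<in> carrier G" and n: "n \<in> carrier G"
    and comm: "f (g b) = g (f b)" and fb: "f b = n \<otimes> b" and gn: "g n = n"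
    and central: "\<And>x. x \<in> carrier G \<Longrightarrow> x \<otimes> n = n \<otimes> x"
  shows "f (g b \<otimes> inv b) = g b \<otimes> inv b"
proof -
  interpret f: group_hom G G f by unfold_locales (rule f)
  interpret g: group_hom G G g by unfold_locales (rule g)
  have "f (g b \<otimes> inv b) = (n \<otimes> g b) \<otimes> inv (n \<otimes> b)"
    using b n by (simp add: comm fb gn)
  also have "\<dots> = (g b \<otimes> n) \<otimes> (inv n \<otimes> inv b)"
    using b n central[of "g b"] central[of b] by (simp flip: inv_mult_group)
  also have "\<dots> = g b \<otimes> inv b"
    using b n by (metis g.hom_closed inv_closed m_assoc m_closed r_inv r_one)
  finally show ?thesis .
qed

lemma (in group) conjugation_hom:
  assumes z: "z \<in> carrier G"
  shows "(\<lambda>b. z \<otimes> b \<otimes> inv z) \<in> hom G G"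
proof (rule homI)
  fix x y assume xy: "x \<in> carrier G" "y \<in> carrier G"
  have "inv z \<otimes> (z \<otimes> (y \<otimes> inv z)) = y \<otimes> inv z"
    using z xy by (simp flip: m_assoc)
  then show "z \<otimes> (x \<otimes> y) \<otimes> inv z = (z \<otimes> x \<otimes> inv z) \<otimes> (z \<otimes> y \<otimes> inv z)"
    using z xy by (simp add: m_assoc)
qed (use z in simp)

context skew_brace
begin

definition lam :: "'a \<Rightarrow> 'a \<Rightarrow> 'a" where
  "lam a b = inv a \<otimes> (a \<otimes>\<^bsub>C\<^esub> b)"

lemma lam_closed [simp]:
  "\<lbrakk>a \<in> carrier G; b \<in> carrier G\<rbrakk> \<Longrightarrow> lam a b \<in> carrier G"
  by (simp add: lam_def)

lemma star_eq_lam: "star G C a b = lam a b \<otimes> inv b"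
  by (simp add: star_def lam_def)

lemma circ_eq_lam:
  "\<lbrakk>a \<in> carrier G; b \<in> carrier G\<rbrakk> \<Longrightarrow> a \<otimes>\<^bsub>C\<^esub> b = a \<otimes> lam a b"
  by (simp add: lam_def flip: dot.m_assoc)

lemma lam_hom:
  assumes "a \<in> carrier G"
  shows "lam a \<in> hom G G"
proof (rule homI)
  fix x y assume "x \<in> carrier G" "y \<in> carrier G"
  then show "lam a (x \<otimes> y) = lam a x \<otimes> lam a y"
    using assms by (simp add: lam_def brace dot.m_assoc)
qed (use assms in simp)

lemma lam_circ:
  assumes a: "a \<in> carrier G" and b: "b \<in> carrier G" and c: "c \<in> carrier G"
  shows "lam (a \<otimes>\<^bsub>C\<^esub> b) c = lam a (lam b c)"
proof -
  interpret L: group_hom G G "lam a" by unfold_locales (rule lam_hom[OF a])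
  have "a \<otimes> lam a b \<otimes> lam (a \<otimes>\<^bsub>C\<^esub> b) c = (a \<otimes>\<^bsub>C\<^esub> b) \<otimes>\<^bsub>C\<^esub> c"
    using a b c by (metis circ_closed circ_eq_lam)
  also have "\<dots> = a \<otimes>\<^bsub>C\<^esub> (b \<otimes>\<^bsub>C\<^esub> c)"
    using a b c carrier_eq by (simp add: circ.m_assoc)
  also have "\<dots> = a \<otimes> lam a b \<otimes> lam a (lam b c)"
    using a b c by (simp add: circ_eq_lam dot.m_assoc)
  finally show ?thesis
    using a b c by (simp add: dot.m_assoc)
qed

lemma lam_fixes_Ann:
  assumes "a \<in> carrier G" "n \<in> Ann G C"
  shows "lam a n = n"
proof -
  have "lam a n = inv a \<otimes> (a \<otimes> n)"
    using AnnD(3,4)[OF assms(2,1)] by (simp add: lam_def)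
  then show ?thesis
    using assms(1) AnnD(1)[OF assms(2)] by (simp flip: dot.m_assoc)
qed

lemma lam_Ann_mult:
  assumes n: "n \<in> Ann G C" and a: "a \<in> carrier G" and b: "b \<in> carrier G"
  shows "lam (n \<otimes> a) b = lam a b"
proof -
  have "lam n (lam a b) = lam a b"
    using AnnD[OF n] a b by (simp add: lam_def flip: dot.m_assoc)
  then show ?thesis
    using lam_circ[of n a b] AnnD[OF n] a b by simp
qed

text \<open>The coset of \<open>z\<close> lies in the annihilator of the quotient, so the four products of \<open>z\<close> and \<open>x\<close>
  agree modulo \<open>Ann G C\<close>.  These are the comparisons that the two commutation arguments need,
  with the discrepancy made explicit as a left factor.\<close>

lemma Ann2D:
  assumes z: "z \<in> Ann2 G C"
  shows "z \<in> carrier G"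
    and "x \<in> carrier G \<Longrightarrow> \<exists>n \<in> Ann G C. z \<otimes>\<^bsub>C\<^esub> x = n \<otimes> (z \<otimes> x)"
    and "x \<in> carrier G \<Longrightarrow> \<exists>n \<in> Ann G C. x \<otimes>\<^bsub>C\<^esub> z = n \<otimes> (x \<otimes> z)"
    and "x \<in> carrier G \<Longrightarrow> \<exists>n \<in> Ann G C. z \<otimes> x = n \<otimes> (x \<otimes> z)"
    and "x \<in> carrier G \<Longrightarrow> \<exists>n \<in> Ann G C. z \<otimes>\<^bsub>C\<^esub> x = n \<otimes> (x \<otimes>\<^bsub>C\<^esub> z)"
proof -
  let ?N = "Ann G C"
  note N = brace_ideal_Ann
  have sub: "subgroup ?N G" using Ann_normal_dot by (rule normal_imp_subgroup)
  have J: "brace_ideal G C (Ann2 G C)"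
      "Ann (G Mod ?N) (C Mod ?N) = (\<lambda>a. ?N #> a) ` Ann2 G C"
    using theI'[OF ex1_Ann2] unfolding Ann2_def by blast+
  show zc: "z \<in> carrier G"
    using J(1) z subgroup.subset[OF normal_imp_subgroup] by (auto simp: brace_ideal_def)
  interpret Q: skew_brace "G Mod ?N" "C Mod ?N" by (rule quotient_skew_brace[OF N])
  have Z: "?N #> z \<in> Ann (G Mod ?N) (C Mod ?N)" using J(2) z by blast
  have coset: "\<exists>n \<in> ?N. u = n \<otimes> v" if "?N #> u = ?N #> v" "u \<in> carrier G" for u v
    using dot.rcos_self[OF that(2) sub] that(1) by (auto simp: r_coset_def)
  assume x: "x \<in> carrier G"
  then have X: "?N #> x \<in> carrier (G Mod ?N)" by (auto simp: carrier_FactGroup)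
  have E: "?N #> (z \<otimes>\<^bsub>C\<^esub> x) = ?N #> (z \<otimes> x)" "?N #> (x \<otimes>\<^bsub>C\<^esub> z) = ?N #> (z \<otimes> x)"
      "?N #> (x \<otimes> z) = ?N #> (z \<otimes> x)"
    using Q.AnnD(2-4)[OF Z X] by (simp_all only: quotient_mult[OF N zc x] quotient_mult[OF N x zc])
  show "\<exists>n \<in> ?N. z \<otimes>\<^bsub>C\<^esub> x = n \<otimes> (z \<otimes> x)" "\<exists>n \<in> ?N. x \<otimes>\<^bsub>C\<^esub> z = n \<otimes> (x \<otimes> z)"
    "\<exists>n \<in> ?N. z \<otimes> x = n \<otimes> (x \<otimes> z)" "\<exists>n \<in> ?N. z \<otimes>\<^bsub>C\<^esub> x = n \<otimes> (x \<otimes>\<^bsub>C\<^esub> z)"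
    by (rule coset; use E zc x in simp)+
qed

text \<open>The common core of both claims: \<open>\<lambda>\<^sub>z\<close> and conjugation by \<open>z\<close> each satisfy the hypotheses on
  \<open>f\<close>.  It passes from the generators of the derived ideal to all its elements because the fixed
  points of \<open>f\<close> form a subgroup.\<close>

lemma derived_ideal_fixed:
  assumes f: "f \<in> hom G G" and d: "d \<in> derived_ideal G C"
    and comm: "\<And>a b. \<lbrakk>a \<in> carrier G; b \<in> carrier G\<rbrakk> \<Longrightarrow> f (lam a b) = lam a (f b)"
    and moves: "\<And>b. b \<in> carrier G \<Longrightarrow> \<exists>n \<in> Ann G C. f b = n \<otimes> b"
  shows "d \<in> carrier G" "f d = d"
proof -
  have "star G C a b \<in> {x \<in> carrier G. f x = x}" if ab: "a \<in> carrier G" "b \<in> carrier G" for a b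
  proof -
    obtain n where n: "n \<in> Ann G C" "f b = n \<otimes> b" using moves ab by blast
    have "f (lam a b \<otimes> inv b) = lam a b \<otimes> inv b"
      by (rule dot.fixes_twisted_quotient[OF f lam_hom[OF ab(1)] ab(2) AnnD(1)[OF n(1)]
            comm[OF ab] n(2) lam_fixes_Ann[OF ab(1) n(1)] AnnD(4)[OF n(1)]])
    then show ?thesis using ab by (simp add: star_eq_lam)
  qed
  then have "derived_ideal G C \<subseteq> {x \<in> carrier G. f x = x}"
    unfolding derived_ideal_def star_sets_def
    by (intro dot.generate_subgroup_incl dot.fixed_points_subgroup[OF f]) blast
  then show "d \<in> carrier G" "f d = d" using d by auto
qed

lemma star_Ann2_derived_ideal:
  assumes z: "z \<in> Ann2 G C" and d: "d \<in> derived_ideal G C"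
  shows "star G C z d = \<one>"
proof -
  note zc = Ann2D(1)[OF z]
  have comm: "lam z (lam a b) = lam a (lam z b)" if ab: "a \<in> carrier G" "b \<in> carrier G" for a b
  proof -
    obtain n where n: "n \<in> Ann G C" "z \<otimes>\<^bsub>C\<^esub> a = n \<otimes> (a \<otimes>\<^bsub>C\<^esub> z)"
      using Ann2D(5)[OF z ab(1)] by blast
    then have "lam (z \<otimes>\<^bsub>C\<^esub> a) b = lam (a \<otimes>\<^bsub>C\<^esub> z) b"
      using ab zc by (simp add: lam_Ann_mult)
    then show ?thesis using ab zc by (simp add: lam_circ)
  qed
  have moves: "\<exists>n \<in> Ann G C. lam z b = n \<otimes> b" if b: "b \<in> carrier G" for b
  proof -
    obtain n where n: "n \<in> Ann G C" "z \<otimes>\<^bsub>C\<^esub> b = n \<otimes> (z \<otimes> b)"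
      using Ann2D(2)[OF z b] by blast
    have "n \<otimes> (z \<otimes> b) = z \<otimes> (n \<otimes> b)"
      using AnnD(1)[OF n(1)] AnnD(4)[OF n(1) zc] zc b by (simp flip: dot.m_assoc)
    then have "lam z b = n \<otimes> b"
      using AnnD(1)[OF n(1)] zc b n(2) by (simp add: lam_def dot.inv_solve_left')
    then show ?thesis using n(1) by blast
  qed
  have "d \<in> carrier G" "lam z d = d"
    using derived_ideal_fixed[OF lam_hom[OF zc] d comm moves] by blast+
  then show ?thesis by (simp add: star_eq_lam)
qed

lemma bracket_Ann2_derived_ideal:
  assumes z: "z \<in> Ann2 G C" and d: "d \<in> derived_ideal G C"
  shows "bracket G z d = \<one>"
proof -
  note zc = Ann2D(1)[OF z]
  let ?f = "\<lambda>b. z \<otimes> b \<otimes> inv z"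
  have comm: "?f (lam a b) = lam a (?f b)" if ab: "a \<in> carrier G" "b \<in> carrier G" for a b
  proof -
    interpret L: group_hom G G "lam a" by unfold_locales (rule lam_hom[OF ab(1)])
    obtain n where n: "n \<in> Ann G C" "a \<otimes>\<^bsub>C\<^esub> z = n \<otimes> (a \<otimes> z)"
      using Ann2D(3)[OF z ab(1)] by blast
    note N = AnnD[OF n(1)]
    have "n \<otimes> (a \<otimes> z) = a \<otimes> (n \<otimes> z)"
      using N(1) N(4)[OF ab(1)] zc ab by (simp flip: dot.m_assoc)
    then have lz: "lam a z = z \<otimes> n"
      using N(1) N(4)[OF zc] zc ab n(2) by (simp add: lam_def dot.inv_solve_left')
    \<comment> \<open>conjugation by \<open>\<lambda>\<^sub>a(z) = z n\<close> is conjugation by \<open>z\<close>, because \<open>n\<close> is central\<close>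
    have "lam a (?f b) = z \<otimes> n \<otimes> lam a b \<otimes> inv (z \<otimes> n)"
      using zc ab by (simp add: lz)
    also have "\<dots> = z \<otimes> (lam a b \<otimes> n) \<otimes> (inv n \<otimes> inv z)"
      using N(1) N(4)[of "lam a b"] zc ab by (simp add: dot.m_assoc dot.inv_mult_group)
    also have "\<dots> = ?f (lam a b)"
    proof -
      have "n \<otimes> (inv n \<otimes> inv z) = inv z"
        using N(1) zc by (simp flip: dot.m_assoc)
      then show ?thesis using N(1) zc ab by (simp add: dot.m_assoc)
    qed
    finally show ?thesis by simp
  qed
  have moves: "\<exists>n \<in> Ann G C. ?f b = n \<otimes> b" if b: "b \<in> carrier G" for b
  proof -
    obtain n where n: "n \<in> Ann G C" "z \<otimes> b = n \<otimes> (b \<otimes> z)"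
      using Ann2D(4)[OF z b] by blast
    then have "?f b = n \<otimes> b"
      using AnnD(1)[OF n(1)] zc b by (simp add: dot.m_assoc)
    then show ?thesis using n(1) by blast
  qed
  have "d \<in> carrier G" "?f d = d"
    using derived_ideal_fixed[OF dot.conjugation_hom[OF zc] d comm moves] by blast+
  then show ?thesis by (simp add: bracket_def)
qed

end

theorem theorem1p6:
  fixes G :: "('a, 'b) monoid_scheme" and C :: "('a, 'c) monoid_scheme"
  assumes "skew_brace G C"
  shows "star_sets G C (Ann2 G C) (derived_ideal G C) = {\<one>\<^bsub>G\<^esub>} \<and>
         bracket_sets G (Ann2 G C) (derived_ideal G C) = {\<one>\<^bsub>G\<^esub>}"
proof -
  interpret skew_brace G C by (rule assms)
  show ?thesis
    unfolding star_sets_def bracket_sets_def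
    using star_Ann2_derived_ideal bracket_Ann2_derived_ideal
    by (intro conjI dot.generate_trivial) auto
qed

end
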